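(* Let $G$ be a Cohen--Macaulay Cameron--Walker graph, consisting of a connected bipartite graph $G_{\mathrm{bip}}$ with vertex partition $\{x_1,\ldots,x_n\}\cup\{y_1,\ldots,y_m\}$, exactly one leaf edge $\{x_i,w_i\}$ attached to each $x_i$, and exactly one pendant triangle on $\{y_j,z_j,w_{n+j}\}$ attached to each $y_j$. Then $$G=\big(G|_{V(G_{\mathrm{bip}})\cup\{z_1,\ldots,z_m\}}\big)^{\pi},\qquad \pi=\{\{x_i\} : 1\le i\le n\}\cup\{\{y_j,z_j\} : 1\le j\le m\},$$ i.e. $G$ is the clique-whiskered graph of the induced subgraph $G|_{V(G_{\mathrm{bip}})\cup\{z_1,\ldots,z_m\}}$ with respect to the clique partition $\pi$, with whisker vertex $w_i$ attached to $\{x_i\}$ and $w_{n+j}$ attached to $\{y_j,z_j\}$.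
   Context: Graphs are finite simple graphs. $\mathrm{m}(G)$ is the maximal size of a matching of $G$ and $\mathrm{im}(G)$ the maximal size of an induced matching. A Cameron--Walker graph is a finite connected simple graph $G$ with $\mathrm{im}(G)=\mathrm{m}(G)$ which is neither a star graph nor a star triangle. $G$ is Cohen--Macaulay if $\Bbbk[V(G)]/I(G)$ is Cohen--Macaulay, where $I(G)$ is the edge ideal (generated by $uv$, $\{u,v\}\in E(G)$). By a known theorem (Hibi--Higashitani--Kimura--O'Keefe) a Cameron--Walker graph is Cohen--Macaulay if and only if it consists of a connected bipartite graph with vertex partition $\{x_1,\ldots,x_n\}\sqcup\{y_1,\ldots,y_m\}$ with exactly one leaf edge attached to each $x_i$ and exactly one pendant triangle attached to each $y_j$. A clique partition $\pi=\{W_1,\ldots,W_r\}$ of a graph $\Gamma$ is a family of cliques (vertex sets inducing complete subgraphs) whose disjoint union is $V(\Gamma)$; the clique-whiskered graph $\Gamma^\pi$ has vertex set $V(\Gamma)\cup\{w_1,\ldots,w_r\}$ (new vertices) and edge set $E(\Gamma)\cup\bigcup_{i=1}^r\{\{x,w_i\}: x\in W_i\}$. $G|_A$ is the induced subgraph on $A$. *)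

theory Defs
  imports
    "HOL-Algebra.Algebra"
    "HOL-Library.Poly_Mapping"
    "HOL-Library.Extended_Nat"
    "HOL-Library.Disjoint_Sets"
    "HOL-Library.Ramsey"
begin

section \<open>Finite simple graphs\<close>

record 'a ugraph =
  verts :: "'a set"
  edges :: "'a set set"

definition fin_simple_graph :: "'a ugraph \<Rightarrow> bool" where
  "fin_simple_graph G \<longleftrightarrow> finite (verts G) \<and>
     (\<forall>e\<in>edges G. \<exists>u\<in>verts G. \<exists>v\<in>verts G. u \<noteq> v \<and> e = {u, v})"

text \<open>The null graph does not count as connected.\<close>

definition graph_connected :: "'a ugraph \<Rightarrow> bool" where
  "graph_connected G \<longleftrightarrow> verts G \<noteq> {} \<and>
     (\<forall>u\<in>verts G. \<forall>v\<in>verts G. (\<lambda>a b. {a, b} \<in> edges G)\<^sup>*\<^sup>* u v)"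

definition induced_subgraph :: "'a ugraph \<Rightarrow> 'a set \<Rightarrow> 'a ugraph" where
  "induced_subgraph G A = \<lparr>verts = verts G \<inter> A, edges = {e \<in> edges G. e \<subseteq> A}\<rparr>"

definition bipartition :: "'a ugraph \<Rightarrow> 'a set \<Rightarrow> 'a set \<Rightarrow> bool" where
  "bipartition G A B \<longleftrightarrow> verts G = A \<union> B \<and> A \<inter> B = {} \<and>
     (\<forall>e\<in>edges G. \<exists>u\<in>A. \<exists>v\<in>B. e = {u, v})"


section \<open>Matchings and Cameron--Walker graphs\<close>

definition matching :: "'a ugraph \<Rightarrow> 'a set set \<Rightarrow> bool" where
  "matching G M \<longleftrightarrow> M \<subseteq> edges G \<and> disjoint M"

definition induced_matching :: "'a ugraph \<Rightarrow> 'a set set \<Rightarrow> bool" where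
  "induced_matching G M \<longleftrightarrow> matching G M \<and> edges (induced_subgraph G (\<Union>M)) = M"

definition matching_number :: "'a ugraph \<Rightarrow> nat" where
  "matching_number G = Max (card ` {M. matching G M})"

definition induced_matching_number :: "'a ugraph \<Rightarrow> nat" where
  "induced_matching_number G = Max (card ` {M. induced_matching G M})"

text \<open>A single vertex is a star with no edges.\<close>

definition star_graph :: "'a ugraph \<Rightarrow> bool" where
  "star_graph G \<longleftrightarrow> (\<exists>c\<in>verts G. edges G = {{c, v} | v. v \<in> verts G - {c}})"

text \<open>
  A star triangle consists of at least one triangle, all sharing the vertex \<open>c\<close> and nothing else;
  \<open>P\<close> is the set of the edges opposite to \<open>c\<close>.
\<close>

definition star_triangle :: "'a ugraph \<Rightarrow> bool" where
  "star_triangle G \<longleftrightarrow> (\<exists>c\<in>verts G. \<exists>P. P \<noteq> {} \<and> partition_on (verts G - {c}) P \<and>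
     (\<forall>e\<in>P. card e = 2) \<and> edges G = P \<union> {{c, v} | v. v \<in> verts G - {c}})"

definition cameron_walker :: "'a ugraph \<Rightarrow> bool" where
  "cameron_walker G \<longleftrightarrow> fin_simple_graph G \<and> graph_connected G \<and>
     induced_matching_number G = matching_number G \<and> \<not> star_graph G \<and> \<not> star_triangle G"

text \<open>
  \<open>G\<close> consists of the connected bipartite graph \<open>B\<close> on \<open>x 1, \<dots>, x n\<close> and \<open>y 1, \<dots>, y m\<close>,
  the leaf edges \<open>{x i, w i}\<close>, and the pendant triangles \<open>{y j, z j, w (n + j)}\<close>.
  The listed vertices are pairwise distinct; only the values of \<open>x, y, z, w\<close> on the stated index
  ranges matter.
\<close>

definition bipartite_with_leaves_and_triangles ::
  "'a ugraph \<Rightarrow> 'a ugraph \<Rightarrow> nat \<Rightarrow> nat \<Rightarrow>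
   (nat \<Rightarrow> 'a) \<Rightarrow> (nat \<Rightarrow> 'a) \<Rightarrow> (nat \<Rightarrow> 'a) \<Rightarrow> (nat \<Rightarrow> 'a) \<Rightarrow> bool" where
  "bipartite_with_leaves_and_triangles G B n m x y z w \<longleftrightarrow>
     fin_simple_graph B \<and> graph_connected B \<and> bipartition B (x ` {1..n}) (y ` {1..m}) \<and>
     inj_on x {1..n} \<and> inj_on y {1..m} \<and> inj_on z {1..m} \<and> inj_on w {1..n+m} \<and>
     z ` {1..m} \<inter> verts B = {} \<and> w ` {1..n+m} \<inter> verts B = {} \<and>
     z ` {1..m} \<inter> w ` {1..n+m} = {} \<and>
     verts G = verts B \<union> z ` {1..m} \<union> w ` {1..n+m} \<and>
     edges G = edges B \<union> (\<Union>i\<in>{1..n}. {{x i, w i}}) \<union>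
       (\<Union>j\<in>{1..m}. {{y j, z j}, {y j, w (n + j)}, {z j, w (n + j)}})"


section \<open>Clique partitions and clique-whiskering\<close>

definition clique_partition :: "'a ugraph \<Rightarrow> 'a set set \<Rightarrow> bool" where
  "clique_partition G \<pi> \<longleftrightarrow> partition_on (verts G) \<pi> \<and> (\<forall>W\<in>\<pi>. clique W (edges G))"

text \<open>
  The clique-whiskered graph is only determined up to the names of its new vertices. They are given
  by \<open>\<omega>\<close>: the whisker vertex attached to the clique \<open>W\<close> is \<open>\<omega> W\<close>.
\<close>

definition whisker_naming :: "'a ugraph \<Rightarrow> 'a set set \<Rightarrow> ('a set \<Rightarrow> 'a) \<Rightarrow> bool" where
  "whisker_naming G \<pi> \<omega> \<longleftrightarrow> inj_on \<omega> \<pi> \<and> \<omega> ` \<pi> \<inter> verts G = {}"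

definition clique_whiskered :: "'a ugraph \<Rightarrow> 'a set set \<Rightarrow> ('a set \<Rightarrow> 'a) \<Rightarrow> 'a ugraph" where
  "clique_whiskered G \<pi> \<omega> =
     \<lparr>verts = verts G \<union> \<omega> ` \<pi>, edges = edges G \<union> (\<Union>W\<in>\<pi>. {{x, \<omega> W} | x. x \<in> W})\<rparr>"


section \<open>Cohen--Macaulay rings and graphs\<close>

definition regular_sequence :: "('r, 'q) ring_scheme \<Rightarrow> 'r list \<Rightarrow> bool" where
  "regular_sequence R as \<longleftrightarrow> set as \<subseteq> carrier R \<and> genideal R (set as) \<noteq> carrier R \<and>
     (\<forall>i<length as. \<forall>b\<in>carrier R.
        as ! i \<otimes>\<^bsub>R\<^esub> b \<in> genideal R (set (take i as)) \<longrightarrow> b \<in> genideal R (set (take i as)))"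

definition ideal_depth :: "('r, 'q) ring_scheme \<Rightarrow> 'r set \<Rightarrow> enat" where
  "ideal_depth R I = Sup {enat (length as) | as. regular_sequence R as \<and> set as \<subseteq> I}"

definition prime_codim :: "('r, 'q) ring_scheme \<Rightarrow> 'r set \<Rightarrow> enat" where
  "prime_codim R I = Sup {enat k | k. \<exists>P. (\<forall>i\<le>k. primeideal (P i) R) \<and>
     (\<forall>i<k. P i \<subset> P (Suc i)) \<and> P k = I}"

text \<open>
  The definition of Eisenbud (Commutative Algebra, Section 18.2) and Kaplansky (Commutative Rings,
  Section 3-1). Since the depth of a maximal ideal \<open>M\<close> of a Noetherian ring is the depth of the
  local ring at \<open>M\<close>, and its codimension the Krull dimension of that local ring, this says that all
  localizations at maximal ideals are Cohen--Macaulay.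
\<close>

definition cohen_macaulay_ring :: "('r, 'q) ring_scheme \<Rightarrow> bool" where
  "cohen_macaulay_ring R \<longleftrightarrow> cring R \<and> noetherian_ring R \<and>
     (\<forall>M. maximalideal M R \<longrightarrow> ideal_depth R M = prime_codim R M)"

text \<open>
  The polynomial ring over \<open>'k\<close> in the variables \<open>V\<close>. A monomial is its finitely supported
  exponent vector and a polynomial a finitely supported family of coefficients; the operations are
  those of \<^typ>\<open>('a \<Rightarrow>\<^sub>0 nat) \<Rightarrow>\<^sub>0 'k\<close>.
\<close>

definition mpoly_ring :: "'k::field itself \<Rightarrow> 'a set \<Rightarrow> (('a \<Rightarrow>\<^sub>0 nat) \<Rightarrow>\<^sub>0 'k) ring" where
  "mpoly_ring K V =
     \<lparr>carrier = {p. \<forall>t \<in> Poly_Mapping.keys p. Poly_Mapping.keys t \<subseteq> V},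
      monoid.mult = (*), one = 1, ring.zero = 0, add = (+)\<rparr>"

definition mpoly_var :: "'a \<Rightarrow> ('a \<Rightarrow>\<^sub>0 nat) \<Rightarrow>\<^sub>0 'k::field" where
  "mpoly_var v = Poly_Mapping.single (Poly_Mapping.single v 1) 1"

definition edge_ideal :: "'k::field itself \<Rightarrow> 'a ugraph \<Rightarrow> (('a \<Rightarrow>\<^sub>0 nat) \<Rightarrow>\<^sub>0 'k) set" where
  "edge_ideal K G =
     genideal (mpoly_ring K (verts G)) {mpoly_var u * mpoly_var v | u v. {u, v} \<in> edges G}"

definition cohen_macaulay_graph :: "'k::field itself \<Rightarrow> 'a ugraph \<Rightarrow> bool" where
  "cohen_macaulay_graph K G \<longleftrightarrow>
     cohen_macaulay_ring (mpoly_ring K (verts G) Quot edge_ideal K G)"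

lemma keys_plus_le:
  assumes "\<forall>t \<in> Poly_Mapping.keys p. P t" "\<forall>t \<in> Poly_Mapping.keys q. P t"
  shows "\<forall>t \<in> Poly_Mapping.keys (p + q). P t"
  using assms keys_add[of p q] by blast

lemma keys_times_le:
  fixes p q :: "('a \<Rightarrow>\<^sub>0 nat) \<Rightarrow>\<^sub>0 'k::field"
  assumes "\<forall>t \<in> Poly_Mapping.keys p. Poly_Mapping.keys t \<subseteq> V"
    and "\<forall>t \<in> Poly_Mapping.keys q. Poly_Mapping.keys t \<subseteq> V"
  shows "\<forall>t \<in> Poly_Mapping.keys (p * q). Poly_Mapping.keys t \<subseteq> V"
proof
  fix t assume "t \<in> Poly_Mapping.keys (p * q)"
  then obtain a b where "t = a + b" "a \<in> Poly_Mapping.keys p" "b \<in> Poly_Mapping.keys q"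
    using keys_mult[of p q] by blast
  with assms show "Poly_Mapping.keys t \<subseteq> V" using keys_add[of a b] by blast
qed

lemma cring_mpoly_ring: "cring (mpoly_ring K V)"
proof (rule cringI)
  show "abelian_group (mpoly_ring K V)"
  proof (rule abelian_groupI)
    fix p q assume "p \<in> carrier (mpoly_ring K V)" "q \<in> carrier (mpoly_ring K V)"
    then show "p \<oplus>\<^bsub>mpoly_ring K V\<^esub> q \<in> carrier (mpoly_ring K V)"
      unfolding mpoly_ring_def using keys_plus_le[of p _ q] by simp
    show "p \<oplus>\<^bsub>mpoly_ring K V\<^esub> q = q \<oplus>\<^bsub>mpoly_ring K V\<^esub> p"
      by (simp add: mpoly_ring_def add.commute)
  next
    fix p assume p: "p \<in> carrier (mpoly_ring K V)"
    show "\<exists>q\<in>carrier (mpoly_ring K V). q \<oplus>\<^bsub>mpoly_ring K V\<^esub> p = \<zero>\<^bsub>mpoly_ring K V\<^esub>"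
      by (rule bexI[of _ "- p"]) (use p in \<open>simp_all add: mpoly_ring_def\<close>)
  qed (simp_all add: mpoly_ring_def add.assoc)
  show "comm_monoid (mpoly_ring K V)"
  proof (rule comm_monoidI)
    fix p q assume "p \<in> carrier (mpoly_ring K V)" "q \<in> carrier (mpoly_ring K V)"
    then show "p \<otimes>\<^bsub>mpoly_ring K V\<^esub> q \<in> carrier (mpoly_ring K V)"
      unfolding mpoly_ring_def using keys_times_le[of p V q] by simp
    show "p \<otimes>\<^bsub>mpoly_ring K V\<^esub> q = q \<otimes>\<^bsub>mpoly_ring K V\<^esub> p"
      by (simp add: mpoly_ring_def mult.commute)
  qed (simp_all add: mpoly_ring_def mult.assoc)
qed (simp add: mpoly_ring_def distrib_right)

lemma cring_edge_ring:
  assumes "fin_simple_graph G"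
  shows "cring (mpoly_ring K (verts G) Quot edge_ideal K G)"
proof -
  interpret cring "mpoly_ring K (verts G)" by (rule cring_mpoly_ring)
  have "{mpoly_var u * mpoly_var v | u v. {u, v} \<in> edges G} \<subseteq> carrier (mpoly_ring K (verts G))"
  proof clarify
    fix u v assume "{u, v} \<in> edges G"
    with assms obtain a b where "a \<in> verts G" "b \<in> verts G" "{u, v} = {a, b}"
      unfolding fin_simple_graph_def by metis
    then have "u \<in> verts G" "v \<in> verts G"
      by (auto simp: doubleton_eq_iff)
    then show "mpoly_var u * mpoly_var v \<in> carrier (mpoly_ring K (verts G))"
      using keys_times_le[of "mpoly_var u" "verts G" "mpoly_var v"]
      by (simp add: mpoly_ring_def mpoly_var_def)
  qed
  then have "ideal (edge_ideal K G) (mpoly_ring K (verts G))"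
    unfolding edge_ideal_def by (rule genideal_ideal)
  then show ?thesis by (rule ideal.quotient_is_cring[OF _ is_cring])
qed

end

theory Submission
  imports Defs
begin

text \<open>
  Deleting the vertices \<open>w k\<close> from \<open>G\<close> leaves the bipartite graph together with the edges
  \<open>{y j, z j}\<close>. The deleted edges are exactly the edges at the vertices \<open>w k\<close>, and the neighbourhood
  of \<open>w k\<close> is the clique \<open>{x k}\<close> if \<open>k \<le> n\<close> and \<open>{y j, z j}\<close> if \<open>k = n + j\<close>. These cliques partition
  the remaining vertices, and restoring the deleted edges is clique-whiskering. The cliques are
  listed without repetition by the index set \<open>{1..n+m}\<close>, so that assigning \<open>w k\<close> to the \<open>k\<close>-th
  clique is a well-defined injective naming of the whisker vertices.
\<close>

text \<open>
  The neighbourhood of \<open>w k\<close> in \<open>G\<close>, for \<open>k\<close> in \<open>{1..n+m}\<close>: indices up to \<open>n\<close> belong to leaves, and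
  \<open>n + j\<close> to the triangle at \<open>y j\<close>.
\<close>

definition whisker_clique :: "nat \<Rightarrow> (nat \<Rightarrow> 'a) \<Rightarrow> (nat \<Rightarrow> 'a) \<Rightarrow> (nat \<Rightarrow> 'a) \<Rightarrow> nat \<Rightarrow> 'a set" where
  "whisker_clique n x y z k = (if k \<le> n then {x k} else {y (k - n), z (k - n)})"

lemma whisker_clique_leaf [simp]: "i \<in> {1..n} \<Longrightarrow> whisker_clique n x y z i = {x i}"
  by (simp add: whisker_clique_def)

lemma whisker_clique_triangle:
  "j \<in> {1..m} \<Longrightarrow> whisker_clique n x y z (n + j) = {y j, z j}"
  by (simp add: whisker_clique_def)

lemma atLeastAtMost_add_eq: "{1..n+m} = {1..n} \<union> (+) n ` {1..m}" for n m :: nat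
proof -
  have "(+) n ` {1..m} = {n+1..n+m}" by simp
  then show ?thesis by auto
qed

lemma image_whisker_clique:
  "whisker_clique n x y z ` {1..n+m} =
     {{x i} | i. i \<in> {1..n}} \<union> {{y j, z j} | j. j \<in> {1..m}}"
proof -
  have "whisker_clique n x y z ` {1..n} = (\<lambda>i. {x i}) ` {1..n}"
    by (intro image_cong refl whisker_clique_leaf)
  moreover have "whisker_clique n x y z ` (+) n ` {1..m} = (\<lambda>j. {y j, z j}) ` {1..m}"
    unfolding image_image by (intro image_cong refl whisker_clique_triangle)
  ultimately show ?thesis
    unfolding atLeastAtMost_add_eq image_Un by (simp only: Setcompr_eq_image)
qed

text \<open>
  Used with \<open>F\<close> sending a clique and its whisker vertex to the set of edges joining them.
\<close>

lemma UN_whisker_clique: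
  "(\<Union>k\<in>{1..n+m}. F (whisker_clique n x y z k) (w k)) =
     (\<Union>i\<in>{1..n}. F {x i} (w i)) \<union> (\<Union>j\<in>{1..m}. F {y j, z j} (w (n + j)))"
proof -
  have "(\<Union>k\<in>{1..n}. F (whisker_clique n x y z k) (w k)) = (\<Union>i\<in>{1..n}. F {x i} (w i))"
    by (intro SUP_cong refl) simp
  moreover have "(\<Union>j\<in>{1..m}. F (whisker_clique n x y z (n + j)) (w (n + j))) =
      (\<Union>j\<in>{1..m}. F {y j, z j} (w (n + j)))"
    by (intro SUP_cong refl) (simp only: whisker_clique_triangle)
  ultimately show ?thesis
    unfolding atLeastAtMost_add_eq UN_Un by (simp del: image_add_atLeastAtMost)
qed

lemma whisker_clique_disjoint:
  assumes "x ` {1..n} \<inter> y ` {1..m} = {}" "z ` {1..m} \<inter> (x ` {1..n} \<union> y ` {1..m}) = {}"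
    and "inj_on x {1..n}" "inj_on y {1..m}" "inj_on z {1..m}"
    and "k \<in> {1..n+m}" "l \<in> {1..n+m}" "k \<noteq> l"
  shows "whisker_clique n x y z k \<inter> whisker_clique n x y z l = {}"
proof -
  have xy: "x i \<noteq> y j" and xz: "x i \<noteq> z j" if "i \<in> {1..n}" "j \<in> {1..m}" for i j
    using assms(1,2) that by fast+
  have yz: "y i \<noteq> z j" if "i \<in> {1..m}" "j \<in> {1..m}" for i j
    using assms(2) that by fast
  have inj: "x i = x j \<longleftrightarrow> i = j" if "i \<in> {1..n}" "j \<in> {1..n}" for i j
    using assms(3) that by (rule inj_on_eq_iff)
  have inj': "y i = y j \<longleftrightarrow> i = j" "z i = z j \<longleftrightarrow> i = j" if "i \<in> {1..m}" "j \<in> {1..m}" for i j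
    using assms(4,5) that by (simp_all add: inj_on_eq_iff)
  have "k \<in> {1..n} \<or> (\<exists>i\<in>{1..m}. k = n + i)" "l \<in> {1..n} \<or> (\<exists>i\<in>{1..m}. l = n + i)"
    using assms(6,7) unfolding atLeastAtMost_add_eq by blast+
  then show ?thesis
    using \<open>k \<noteq> l\<close>
    by (elim disjE bexE)
      (simp_all only: whisker_clique_leaf whisker_clique_triangle Int_insert_left Int_empty_left
        insert_iff empty_iff xy xz yz xy[symmetric] xz[symmetric] yz[symmetric] inj inj'
        if_False simp_thms add_left_cancel)
qed

text \<open>Deleting all \<open>w k\<close> removes every leaf edge and leaves one edge of every pendant triangle.\<close>

lemma induced_subgraph_without_whiskers:
  assumes "bipartite_with_leaves_and_triangles G B n m x y z w"
  shows "induced_subgraph G (verts B \<union> z ` {1..m}) =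
    \<lparr>verts = verts B \<union> z ` {1..m}, edges = edges B \<union> (\<Union>j\<in>{1..m}. {{y j, z j}})\<rparr>"
proof -
  define A where "A = verts B \<union> z ` {1..m}"
  have V: "verts G = A \<union> w ` {1..n+m}" and W: "w ` {1..n+m} \<inter> A = {}"
    and B: "fin_simple_graph B" and yB: "y ` {1..m} \<subseteq> verts B"
    and E: "edges G = edges B \<union> (\<Union>i\<in>{1..n}. {{x i, w i}}) \<union>
       (\<Union>j\<in>{1..m}. {{y j, z j}, {y j, w (n + j)}, {z j, w (n + j)}})"
    using assms by (auto simp: A_def bipartite_with_leaves_and_triangles_def bipartition_def)
  have wi: "w i \<notin> A" if "i \<in> {1..n}" for i
    using W that by (auto simp: disjoint_iff)
  have wj: "w (n + j) \<notin> A" if "j \<in> {1..m}" for j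
    using W that by (auto simp: disjoint_iff)
  have EB: "e \<subseteq> A" if "e \<in> edges B" for e
    using B that unfolding fin_simple_graph_def A_def by force
  have yz: "{y j, z j} \<subseteq> A" if "j \<in> {1..m}" for j
    using yB that by (auto simp: A_def)
  have "{e \<in> edges G. e \<subseteq> A} = edges B \<union> (\<Union>j\<in>{1..m}. {{y j, z j}})"
  proof (intro equalityI subsetI)
    fix e assume "e \<in> {e \<in> edges G. e \<subseteq> A}"
    then show "e \<in> edges B \<union> (\<Union>j\<in>{1..m}. {{y j, z j}})"
      unfolding E by (auto simp: wi wj simp del: atLeastAtMost_iff)
  next
    fix e assume "e \<in> edges B \<union> (\<Union>j\<in>{1..m}. {{y j, z j}})"
    then show "e \<in> {e \<in> edges G. e \<subseteq> A}"
      unfolding E using EB yz by (auto simp del: atLeastAtMost_iff insert_subset)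
  qed
  moreover have "verts G \<inter> A = A" using V by blast
  ultimately show ?thesis
    unfolding induced_subgraph_def A_def[symmetric] by simp
qed

theorem lemma4p15:
  fixes G G_bip :: "'a ugraph"
    and n m :: nat
    and x y z w :: "nat \<Rightarrow> 'a"
  assumes "cameron_walker G"
    and "cohen_macaulay_graph TYPE('k::field) G"
    and "bipartite_with_leaves_and_triangles G G_bip n m x y z w"
  shows "let \<Gamma> = induced_subgraph G (verts G_bip \<union> z ` {1..m});
             \<pi> = {{x i} | i. i \<in> {1..n}} \<union> {{y j, z j} | j. j \<in> {1..m}}
         in clique_partition \<Gamma> \<pi> \<and>
            (\<exists>\<omega>. whisker_naming \<Gamma> \<pi> \<omega> \<and>
                 (\<forall>i\<in>{1..n}. \<omega> {x i} = w i) \<and>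
                 (\<forall>j\<in>{1..m}. \<omega> {y j, z j} = w (n + j)) \<and>
                 G = clique_whiskered \<Gamma> \<pi> \<omega>)"
proof -
  define \<Gamma> where "\<Gamma> = induced_subgraph G (verts G_bip \<union> z ` {1..m})"
  define \<pi> where "\<pi> = {{x i} | i. i \<in> {1..n}} \<union> {{y j, z j} | j. j \<in> {1..m}}"
  define W where "W = whisker_clique n x y z"
  define \<omega> where "\<omega> = w \<circ> inv_into {1..n+m} W"
  have VB: "verts G_bip = x ` {1..n} \<union> y ` {1..m}" and xy: "x ` {1..n} \<inter> y ` {1..m} = {}"
    and inj: "inj_on x {1..n}" "inj_on y {1..m}" "inj_on z {1..m}" and w_inj: "inj_on w {1..n+m}"
    and zB: "z ` {1..m} \<inter> verts G_bip = {}" and wB: "w ` {1..n+m} \<inter> verts G_bip = {}"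
    and zw: "z ` {1..m} \<inter> w ` {1..n+m} = {}"
    and VG: "verts G = verts G_bip \<union> z ` {1..m} \<union> w ` {1..n+m}"
    and EG: "edges G = edges G_bip \<union> (\<Union>i\<in>{1..n}. {{x i, w i}}) \<union>
      (\<Union>j\<in>{1..m}. {{y j, z j}, {y j, w (n + j)}, {z j, w (n + j)}})"
    using assms(3) unfolding bipartite_with_leaves_and_triangles_def bipartition_def
    by - (elim conjE, assumption)+
  have \<Gamma>: "verts \<Gamma> = verts G_bip \<union> z ` {1..m}"
      "edges \<Gamma> = edges G_bip \<union> (\<Union>j\<in>{1..m}. {{y j, z j}})"
    unfolding \<Gamma>_def induced_subgraph_without_whiskers[OF assms(3)] by simp_all
  have \<pi>W: "\<pi> = W ` {1..n+m}"
    unfolding \<pi>_def W_def image_whisker_clique ..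
  have W_disj: "W k \<inter> W l = {}" if "k \<in> {1..n+m}" "l \<in> {1..n+m}" "k \<noteq> l" for k l
    unfolding W_def by (rule whisker_clique_disjoint[OF xy zB[unfolded VB] inj that])
  have W_ne: "W k \<noteq> {}" for k
    by (simp add: W_def whisker_clique_def)
  have W_inj: "inj_on W {1..n+m}"
    \<comment> \<open>Disjoint nonempty sets are distinct.\<close>
    using W_disj W_ne by (intro inj_onI) (metis Int_absorb)
  have \<omega>W: "\<omega> (W k) = w k" if "k \<in> {1..n+m}" for k
    using W_inj that by (simp add: \<omega>_def)
  have img: "\<omega> ` \<pi> = w ` {1..n+m}"
    unfolding \<pi>W image_image using \<omega>W by (intro image_cong refl)

  have "partition_on (verts \<Gamma>) \<pi>"
  proof (rule partition_onI)
    show "\<Union>\<pi> = verts \<Gamma>"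
      unfolding \<Gamma> VB \<pi>_def by blast
    show "disjnt p q" if "p \<in> \<pi>" "q \<in> \<pi>" "p \<noteq> q" for p q
      using that W_disj unfolding \<pi>W disjnt_def by blast
    show "{} \<notin> \<pi>"
      using W_ne unfolding \<pi>W by force
  qed
  moreover have "clique p (edges \<Gamma>)" if "p \<in> \<pi>" for p
    using that unfolding \<pi>_def \<Gamma> clique_def by (auto simp: insert_commute)
  ultimately have cp: "clique_partition \<Gamma> \<pi>"
    by (simp add: clique_partition_def)

  have "inj_on \<omega> \<pi>"
    unfolding \<pi>W using w_inj \<omega>W by (intro inj_onI) (auto simp: inj_on_eq_iff)
  moreover have "\<omega> ` \<pi> \<inter> verts \<Gamma> = {}"
    unfolding img \<Gamma> using wB zw by blast
  ultimately have wn: "whisker_naming \<Gamma> \<pi> \<omega>"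
    by (simp add: whisker_naming_def)

  have \<omega>x: "\<omega> {x i} = w i" if "i \<in> {1..n}" for i
    using \<omega>W[of i] that by (simp add: W_def)
  have \<omega>y: "\<omega> {y j, z j} = w (n + j)" if "j \<in> {1..m}" for j
    using \<omega>W[of "n + j"] that by (simp add: W_def whisker_clique_triangle[OF that])

  have "(\<Union>p\<in>\<pi>. {{v, \<omega> p} | v. v \<in> p}) = (\<Union>k\<in>{1..n+m}. {{v, w k} | v. v \<in> W k})"
    unfolding \<pi>W by (simp add: \<omega>W)
  also have "\<dots> = (\<Union>i\<in>{1..n}. {{v, w i} | v. v \<in> {x i}}) \<union>
      (\<Union>j\<in>{1..m}. {{v, w (n + j)} | v. v \<in> {y j, z j}})"
    unfolding W_def by (rule UN_whisker_clique[where F = "\<lambda>p u. {{v, u} | v. v \<in> p}"])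
  finally have whiskers: "(\<Union>p\<in>\<pi>. {{v, \<omega> p} | v. v \<in> p}) = \<dots>" .
  have "{{v, w i} | v. v \<in> {x i}} = {{x i, w i}}" for i by blast
  moreover have "{{v, w (n + j)} | v. v \<in> {y j, z j}} =
      {{y j, w (n + j)}, {z j, w (n + j)}}" for j by blast
  moreover have "(\<Union>j\<in>{1..m}. {{y j, z j}, {y j, w (n + j)}, {z j, w (n + j)}}) =
      (\<Union>j\<in>{1..m}. {{y j, z j}}) \<union> (\<Union>j\<in>{1..m}. {{y j, w (n + j)}, {z j, w (n + j)}})"
    by blast
  ultimately have "edges G = edges \<Gamma> \<union> (\<Union>p\<in>\<pi>. {{v, \<omega> p} | v. v \<in> p})"
    unfolding whiskers \<Gamma> EG by (simp only: Un_ac)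
  moreover have "verts G = verts \<Gamma> \<union> \<omega> ` \<pi>"
    unfolding img \<Gamma> VG ..
  ultimately have "G = clique_whiskered \<Gamma> \<pi> \<omega>"
    by (simp add: clique_whiskered_def)
  with cp wn \<omega>x \<omega>y show ?thesis
    unfolding Let_def \<Gamma>_def[symmetric] \<pi>_def[symmetric] by blast
qed

end
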